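(* Let $\mathcal{M}$ be a smooth Riemannian submanifold of a finite-dimensional Euclidean space $\mathcal{E}$, with retractions $R_x$ and vector transports $\mathrm{T}_{y\leftarrow x}$ (see context), and let $f:\mathcal{M}\to\mathbb{R}$ be continuously differentiable. Consider the Riemannian Gradient Method with Momentum (described in the context) with inputs $x_0\in\mathcal{M}$, $\gamma\in(0,1)$, $\delta\in(0,1)$, $\epsilon>0$ and $0<c_1\le\lambda_{\min}\le\lambda_0\le\lambda_{\max}\le c_2$, and let $\{x_k\}$ and $\{d_k\}$ be the iterates and directions it generates. Suppose that: (1) there exists $f_{\mathrm{low}}\in\mathbb{R}$ such that $f(x)\ge f_{\mathrm{low}}$ for all $x\in\mathcal{M}$; (2) there exists $L>0$ and, for all $k$, there exists $\rho_k>\|d_k\|$ (possibly $\rho_k=\infty$ for all $k$) such that the retraction $R_{x_k}$ is defined at least on $B(\rho_k)\cap \mathrm{T}_{x_k}\mathcal{M}$, where $B(\rho_k)$ is the ball of radius $\rho_k$ centered at $0$, and, for all $d\in B(\rho_k)\cap \mathrm{T}_{x_k}\mathcal{M}$, $$\big|f(R_{x_k}(d))-f(x_k)-\langle \operatorname{grad} f(x_k),d\rangle\big|\le\frac{L}{2}\|d\|^2.$$ Then the method requires at most $\mathcal{O}(\epsilon^{-2})$ iterations, retractions, function evaluations and gradient evaluations to attain $$\|\operatorname{grad} f(x_k)\|\le\epsilon.$$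
   Context: $\mathcal{M}$ is a smooth embedded submanifold of the Euclidean space $\mathcal{E}$; each tangent space $\mathrm{T}_x\mathcal{M}\subset\mathcal{E}$ carries the inner product $\langle\cdot,\cdot\rangle$ inherited from $\mathcal{E}$, with norm $\|\cdot\|$. The Riemannian gradient $\operatorname{grad} f(x)$ is the unique vector of $\mathrm{T}_x\mathcal{M}$ with $\langle\operatorname{grad} f(x),v\rangle=\mathrm{D}f(x)[v]$ for all $v\in \mathrm{T}_x\mathcal{M}$. For each $x\in\mathcal{M}$, a retraction $R_x$ is a smooth map from $\mathrm{T}_x\mathcal{M}$ (or a ball around $0$ in it) to $\mathcal{M}$ with $R_x(0)=x$ and $\mathrm{D}R_x(0)=\mathrm{Id}$. For $x,y\in\mathcal{M}$, a vector transport is a linear map $\mathrm{T}_{y\leftarrow x}:\mathrm{T}_x\mathcal{M}\to \mathrm{T}_y\mathcal{M}$ such that $\mathrm{T}_{x\leftarrow x}$ is the identity on $\mathrm{T}_x\mathcal{M}$. Riemannian Gradient Method with Momentum. Start with $k=0$ from $x_0$, and write $g_k=\operatorname{grad} f(x_k)$. While $\|g_k\|>\epsilon$, do the following. (a) Direction. If $k=0$, set $d_0=-\lambda_0 g_0$. If $k\ge1$, set $s_k=\mathrm{T}_{x_k\leftarrow x_{k-1}}(\eta_{k-1}d_{k-1})$ and $y_k=g_k-\mathrm{T}_{x_k\leftarrow x_{k-1}}(g_{k-1})$. - If $\langle s_k,y_k\rangle\le0$, set $d_k=-\lambda_{\max}g_k$. - Otherwise, set $$\lambda_k=\min\Big\{\lambda_{\max},\max\Big\{\lambda_{\min},\frac{\|s_k\|^2}{\langle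 s_k,y_k\rangle}\Big\}\Big\},$$ $$\alpha_k=\lambda_k\,\frac{\|g_k\|^2\langle s_k,y_k\rangle-\langle g_k,y_k\rangle\langle g_k,s_k\rangle}{\langle s_k,y_k\rangle\Big(\|g_k\|^2-\frac{\langle g_k,s_k\rangle^2}{\|s_k\|^2}\Big)},\qquad \beta_k=\frac{\alpha_k\langle g_k,y_k\rangle-\langle g_k,s_k\rangle}{\langle s_k,y_k\rangle},$$ and $d_k=-\alpha_kg_k+\beta_ks_k$; then, if $\langle g_k,d_k\rangle>-c_1\|g_k\|^2$ or $\|d_k\|>c_2\|g_k\|$, replace $d_k$ by $-\lambda_kg_k$. (b) Armijo line-search. Set $\eta=1$; while $f(R_{x_k}(\eta d_k))>f(x_k)+\gamma\,\eta\,\langle g_k,d_k\rangle$, replace $\eta$ by $\delta\eta$. Set $\eta_k=\eta$. (c) Update. Set $x_{k+1}=R_{x_k}(\eta_kd_k)$, replace $k$ by $k+1$, and evaluate $f(x_k)$ and $g_k=\operatorname{grad} f(x_k)$. *)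

theory Defs
  imports "HOL-Analysis.Analysis" "HOL-Library.While_Combinator"
begin

section \<open>Differentiability classes\<close>

primrec cont_diff :: "nat \<Rightarrow> ('a::real_normed_vector \<Rightarrow> 'b::real_normed_vector) \<Rightarrow> 'a set \<Rightarrow> bool" where
  "cont_diff 0 F U \<longleftrightarrow> continuous_on U F"
| "cont_diff (Suc k) F U \<longleftrightarrow>
     (\<forall>x\<in>U. F differentiable (at x)) \<and>
     (\<forall>v. cont_diff k (\<lambda>x. frechet_derivative F (at x) v) U)"

text \<open>
  Class \<open>C\<^sup>n\<close> on an open set of a finite-dimensional space, \<open>n = \<infinity>\<close> being smoothness.
\<close>
definition Ck_on :: "enat \<Rightarrow> ('a::real_normed_vector \<Rightarrow> 'b::real_normed_vector) \<Rightarrow> 'a set \<Rightarrow> bool" where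
  "Ck_on n F U \<longleftrightarrow> open U \<and> (\<forall>k. enat k \<le> n \<longrightarrow> cont_diff k F U)"

text \<open>
  A map on an arbitrary subset \<open>X\<close> (a submanifold, or a relatively open subset of a linear
  subspace) is of class \<open>C\<^sup>n\<close> if it extends locally to \<open>C\<^sup>n\<close> maps on open sets.
\<close>
definition Ck_map :: "enat \<Rightarrow> ('a::real_normed_vector \<Rightarrow> 'b::real_normed_vector) \<Rightarrow> 'a set \<Rightarrow> bool" where
  "Ck_map n f X \<longleftrightarrow>
     (\<forall>x\<in>X. \<exists>U F. x \<in> U \<and> Ck_on n F U \<and> (\<forall>y\<in>U \<inter> X. F y = f y))"

section \<open>Riemannian submanifolds of a Euclidean space\<close>

text \<open>Slice charts; the dimension \<open>n\<close> is the same at all points.\<close>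
definition embedded_submanifold :: "'a::euclidean_space set \<Rightarrow> bool" where
  "embedded_submanifold M \<longleftrightarrow>
     (\<exists>n. \<forall>x\<in>M. \<exists>U (V :: 'a set) \<phi> \<psi> S.
        x \<in> U \<and> Ck_on \<infinity> \<phi> U \<and> Ck_on \<infinity> \<psi> V \<and> homeomorphism U V \<phi> \<psi> \<and>
        subspace S \<and> dim S = n \<and> \<phi> ` (M \<inter> U) = S \<inter> V)"

definition smooth_curve_through :: "'a::euclidean_space set \<Rightarrow> 'a \<Rightarrow> (real \<Rightarrow> 'a) \<Rightarrow> bool" where
  "smooth_curve_through M x c \<longleftrightarrow>
     c 0 = x \<and> (\<exists>e>0. Ck_on \<infinity> c {-e<..<e} \<and> c ` {-e<..<e} \<subseteq> M)"

definition tangent_space :: "'a::euclidean_space set \<Rightarrow> 'a \<Rightarrow> 'a set" where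
  "tangent_space M x =
     {v. \<exists>c. smooth_curve_through M x c \<and> (c has_vector_derivative v) (at 0)}"

text \<open>\<open>Df(x)[v]\<close>, for \<open>v\<close> tangent to \<open>M\<close> at \<open>x\<close>: the values of \<open>f\<close> off \<open>M\<close> are irrelevant.\<close>
definition differential :: "'a::euclidean_space set \<Rightarrow> ('a \<Rightarrow> real) \<Rightarrow> 'a \<Rightarrow> 'a \<Rightarrow> real" where
  "differential M f x v =
     (THE a. \<forall>c. smooth_curve_through M x c \<and> (c has_vector_derivative v) (at 0) \<longrightarrow>
                 ((\<lambda>t. f (c t)) has_real_derivative a) (at 0))"

definition rgrad :: "'a::euclidean_space set \<Rightarrow> ('a \<Rightarrow> real) \<Rightarrow> 'a \<Rightarrow> 'a" where
  "rgrad M f x =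
     (THE g. g \<in> tangent_space M x \<and> (\<forall>v\<in>tangent_space M x. g \<bullet> v = differential M f x v))"

text \<open>
  \<open>R x\<close> is a total function in the logic; as a retraction at \<open>x\<close> it is defined on the tangent
  vectors of norm less than \<open>r x\<close>, and \<open>r x = \<infinity>\<close> means on the whole tangent space.
\<close>
definition retr_dom :: "'a::euclidean_space set \<Rightarrow> ('a \<Rightarrow> ereal) \<Rightarrow> 'a \<Rightarrow> 'a set" where
  "retr_dom M r x = {v \<in> tangent_space M x. ereal (norm v) < r x}"

definition retractions_on ::
  "'a::euclidean_space set \<Rightarrow> ('a \<Rightarrow> ereal) \<Rightarrow> ('a \<Rightarrow> 'a \<Rightarrow> 'a) \<Rightarrow> bool" where
  "retractions_on M r R \<longleftrightarrow>
     (\<forall>x\<in>M. 0 < r x \<and>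
        R x ` retr_dom M r x \<subseteq> M \<and>
        Ck_map \<infinity> (R x) (retr_dom M r x) \<and>
        R x 0 = x \<and>
        (R x has_derivative (\<lambda>v. v)) (at 0 within retr_dom M r x))"

text \<open>\<open>T y x\<close> transports from the tangent space at \<open>x\<close> to the one at \<open>y\<close>.\<close>
definition vector_transport ::
  "'a::euclidean_space set \<Rightarrow> ('a \<Rightarrow> 'a \<Rightarrow> 'a \<Rightarrow> 'a) \<Rightarrow> bool" where
  "vector_transport M T \<longleftrightarrow>
     (\<forall>x\<in>M. \<forall>y\<in>M.
        T y x ` tangent_space M x \<subseteq> tangent_space M y \<and>
        (\<forall>u\<in>tangent_space M x. \<forall>v\<in>tangent_space M x. T y x (u + v) = T y x u + T y x v) \<and>
        (\<forall>a. \<forall>u\<in>tangent_space M x. T y x (a *\<^sub>R u) = a *\<^sub>R T y x u)) \<and>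
     (\<forall>x\<in>M. \<forall>u\<in>tangent_space M x. T x x u = u)"

section \<open>Riemannian gradient method with momentum\<close>

record rgmm_params =
  gamma :: real
  delta :: real
  c1 :: real
  c2 :: real
  lam_min :: real
  lam_0 :: real
  lam_max :: real

definition valid_params :: "rgmm_params \<Rightarrow> bool" where
  "valid_params P \<longleftrightarrow>
     0 < gamma P \<and> gamma P < 1 \<and> 0 < delta P \<and> delta P < 1 \<and>
     0 < c1 P \<and> c1 P \<le> lam_min P \<and> lam_min P \<le> lam_0 P \<and>
     lam_0 P \<le> lam_max P \<and> lam_max P \<le> c2 P"

text \<open>
  The state on entering iteration \<open>k\<close>: \<open>pt\<close> is \<open>x\<^sub>k\<close>, and \<open>prev\<close> is
  \<open>(x\<^bsub>k-1\<^esub>, d\<^bsub>k-1\<^esub>, \<eta>\<^bsub>k-1\<^esub>)\<close> (\<open>None\<close> for \<open>k = 0\<close>). The counters give the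
  number of retractions, function evaluations and gradient evaluations made so far.
\<close>
record 'a rgmm_state =
  pt :: 'a
  prev :: "('a \<times> 'a \<times> real) option"
  n_retr :: nat
  n_feval :: nat
  n_geval :: nat

text \<open>
  If \<open>g\<close> and \<open>s\<close> are collinear, the denominator of \<open>\<alpha>\<close> vanishes and \<open>\<alpha> = 0\<close> by the convention for
  division by zero. This choice is immaterial: whatever the value of \<open>\<alpha>\<close>, the resulting
  \<open>-\<alpha> g + \<beta> s\<close> is then \<open>-(\<parallel>s\<parallel>\<^sup>2 / (s \<bullet> y)) g\<close>.
\<close>
definition direction ::
  "rgmm_params \<Rightarrow> 'a::euclidean_space set \<Rightarrow> ('a \<Rightarrow> 'a \<Rightarrow> 'a \<Rightarrow> 'a) \<Rightarrow> ('a \<Rightarrow> real) \<Rightarrow>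
   'a rgmm_state \<Rightarrow> 'a" where
  "direction P M T f \<sigma> =
     (let x = pt \<sigma>; g = rgrad M f x in
      case prev \<sigma> of
        None \<Rightarrow> - lam_0 P *\<^sub>R g
      | Some (x', d', \<eta>') \<Rightarrow>
          (let s = T x x' (\<eta>' *\<^sub>R d');
               y = g - T x x' (rgrad M f x')
           in if s \<bullet> y \<le> 0 then - lam_max P *\<^sub>R g
              else
                (let l = min (lam_max P) (max (lam_min P) ((norm s)\<^sup>2 / (s \<bullet> y)));
                     \<alpha> = l * (((norm g)\<^sup>2 * (s \<bullet> y) - (g \<bullet> y) * (g \<bullet> s)) /
                              ((s \<bullet> y) * ((norm g)\<^sup>2 - (g \<bullet> s)\<^sup>2 / (norm s)\<^sup>2)));
                     \<beta> = (\<alpha> * (g \<bullet> y) - g \<bullet> s) / (s \<bullet> y);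
                     d = - \<alpha> *\<^sub>R g + \<beta> *\<^sub>R s
                 in if g \<bullet> d > - c1 P * (norm g)\<^sup>2 \<or> norm d > c2 P * norm g
                    then - l *\<^sub>R g else d)))"

text \<open>
  Returns the accepted step size and the number of step sizes tried, each trial costing one
  retraction and one function evaluation; \<open>None\<close> if the backtracking does not terminate.
\<close>
definition line_search ::
  "rgmm_params \<Rightarrow> ('a::euclidean_space \<Rightarrow> 'a \<Rightarrow> 'a) \<Rightarrow> ('a \<Rightarrow> real) \<Rightarrow> 'a \<Rightarrow> 'a \<Rightarrow> 'a \<Rightarrow>
   (real \<times> nat) option" where
  "line_search P R f x g d =
     while_option
       (\<lambda>(\<eta>, m). f (R x (\<eta> *\<^sub>R d)) > f x + gamma P * \<eta> * (g \<bullet> d))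
       (\<lambda>(\<eta>, m). (delta P * \<eta>, Suc m))
       (1, 1)"

text \<open>
  One pass through the loop; \<open>None\<close> if the stopping test \<open>\<parallel>grad f(x\<^sub>k)\<parallel> \<le> \<epsilon>\<close> succeeds or the
  line search does not terminate. Nothing is cached between line search and update:
  the retraction and the function value at the accepted step are counted a second time.
\<close>
definition rgmm_step ::
  "rgmm_params \<Rightarrow> 'a::euclidean_space set \<Rightarrow> ('a \<Rightarrow> 'a \<Rightarrow> 'a) \<Rightarrow> ('a \<Rightarrow> 'a \<Rightarrow> 'a \<Rightarrow> 'a) \<Rightarrow>
   ('a \<Rightarrow> real) \<Rightarrow> real \<Rightarrow> 'a rgmm_state \<Rightarrow> 'a rgmm_state option" where
  "rgmm_step P M R T f \<epsilon> \<sigma> =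
     (let x = pt \<sigma>; g = rgrad M f x; d = direction P M T f \<sigma> in
      if norm g > \<epsilon> then
        (case line_search P R f x g d of
           None \<Rightarrow> None
         | Some (\<eta>, m) \<Rightarrow>
             Some \<lparr> pt = R x (\<eta> *\<^sub>R d), prev = Some (x, d, \<eta>),
                    n_retr = n_retr \<sigma> + m + 1,
                    n_feval = n_feval \<sigma> + m + 1,
                    n_geval = n_geval \<sigma> + 1 \<rparr>)
      else None)"

text \<open>
  The state after \<open>k\<close> completed iterations, \<open>None\<close> if the method does not complete \<open>k\<close> iterations.
  Initially \<open>f\<close> and its gradient are evaluated at \<open>x\<^sub>0\<close>.
\<close>
primrec rgmm_iter ::
  "rgmm_params \<Rightarrow> 'a::euclidean_space set \<Rightarrow> ('a \<Rightarrow> 'a \<Rightarrow> 'a) \<Rightarrow> ('a \<Rightarrow> 'a \<Rightarrow> 'a \<Rightarrow> 'a) \<Rightarrow>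
   ('a \<Rightarrow> real) \<Rightarrow> real \<Rightarrow> 'a \<Rightarrow> nat \<Rightarrow> 'a rgmm_state option" where
  "rgmm_iter P M R T f \<epsilon> x0 0 =
     Some \<lparr> pt = x0, prev = None, n_retr = 0, n_feval = 1, n_geval = 1 \<rparr>"
| "rgmm_iter P M R T f \<epsilon> x0 (Suc k) =
     Option.bind (rgmm_iter P M R T f \<epsilon> x0 k) (rgmm_step P M R T f \<epsilon>)"

text \<open>
  The regularity of the pullbacks, required at those iterations \<open>k\<close> which generate a direction
  \<open>d\<^sub>k\<close>, i.e. at which the method has not yet stopped.
\<close>
definition pullbacks_regular ::
  "rgmm_params \<Rightarrow> 'a::euclidean_space set \<Rightarrow> ('a \<Rightarrow> ereal) \<Rightarrow> ('a \<Rightarrow> 'a \<Rightarrow> 'a) \<Rightarrow>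
   ('a \<Rightarrow> 'a \<Rightarrow> 'a \<Rightarrow> 'a) \<Rightarrow> ('a \<Rightarrow> real) \<Rightarrow> real \<Rightarrow> 'a \<Rightarrow> real \<Rightarrow> bool" where
  "pullbacks_regular P M r R T f \<epsilon> x0 L \<longleftrightarrow>
     (\<forall>k \<sigma>. rgmm_iter P M R T f \<epsilon> x0 k = Some \<sigma> \<and> norm (rgrad M f (pt \<sigma>)) > \<epsilon> \<longrightarrow>
        (\<exists>\<rho>::ereal. \<rho> > ereal (norm (direction P M T f \<sigma>)) \<and>
           (\<forall>d\<in>tangent_space M (pt \<sigma>). ereal (norm d) < \<rho> \<longrightarrow>
              d \<in> retr_dom M r (pt \<sigma>) \<and>
              \<bar>f (R (pt \<sigma>) d) - f (pt \<sigma>) - rgrad M f (pt \<sigma>) \<bullet> d\<bar> \<le> L / 2 * (norm d)\<^sup>2)))"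

end

theory Submission
  imports Defs
begin

text \<open>
  The safeguards on the direction give \<open>\<langle>g, d\<rangle> \<le> -c\<^sub>1 \<parallel>g\<parallel>\<^sup>2\<close> and \<open>\<parallel>d\<parallel> \<le> c\<^sub>2 \<parallel>g\<parallel>\<close>. Hence every
  step size \<open>\<eta> \<le> 2 (1 - \<gamma>) c\<^sub>1 / (L c\<^sub>2\<^sup>2)\<close> satisfies the Armijo condition, so each line search
  tries at most \<open>N + 1\<close> step sizes for a fixed \<open>N\<close>, and each iteration with \<open>\<parallel>g\<parallel> > \<epsilon>\<close> decreases \<open>f\<close>
  by at least \<open>\<gamma> \<delta>\<^sup>N c\<^sub>1 \<epsilon>\<^sup>2\<close>. As \<open>f\<close> is bounded below, there are \<open>O(\<epsilon>\<^sup>-\<^sup>2)\<close> such iterations.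
  For the pullback inequality to apply, the directions must be tangent; this rests on the tangent
  spaces being linear subspaces that contain the Riemannian gradient.
\<close>

section \<open>Smooth maps\<close>

text \<open>A Frechet derivative at a point of the open set \<open>U\<close> depends only on values
  in \<open>U\<close>. Maps agreeing on \<open>U\<close> therefore have the same derivatives there,
  and the induction applies to these in turn.\<close>

lemma cont_diff_cong:
  assumes "open U" "\<And>x. x \<in> U \<Longrightarrow> F x = G x"
  shows "cont_diff k F U \<longleftrightarrow> cont_diff k G U"
  using assms(2)
proof (induction k arbitrary: F G)
  case 0
  then show ?case by (simp cong: continuous_on_cong)
next
  case (Suc k)
  have der: "(F has_derivative D) (at x) \<longleftrightarrow> (G has_derivative D) (at x)" if "x \<in> U" for x D
    using has_derivative_transform_within_open[OF _ assms(1) that, of F D UNIV G]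
      has_derivative_transform_within_open[OF _ assms(1) that, of G D UNIV F] Suc.prems
    by auto
  have fd: "frechet_derivative F (at x) = frechet_derivative G (at x)" if "x \<in> U" for x
    using der[OF that] by (simp add: frechet_derivative_def)
  have df: "F differentiable (at x) \<longleftrightarrow> G differentiable (at x)" if "x \<in> U" for x
    using der[OF that] by (simp add: differentiable_def)
  have "cont_diff k (\<lambda>x. frechet_derivative F (at x) v) U \<longleftrightarrow>
        cont_diff k (\<lambda>x. frechet_derivative G (at x) v) U" for v
    by (rule Suc.IH) (simp add: fd)
  then show ?case using df by auto
qed

text \<open>Serves to show that the preimage of a straight line under a chart is a smooth curve.
  Along a line the derivative in direction \<open>h\<close> is \<open>DF(p + t w)[h w]\<close>,
  again a directional derivative of \<open>F\<close> restricted to the same line, so the induction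
  closes without a higher-order chain rule.\<close>

lemma cont_diff_along_line:
  fixes F :: "'a::real_normed_vector \<Rightarrow> 'b::real_normed_vector"
  assumes "open V" "cont_diff k F V"
  shows "cont_diff k (\<lambda>t::real. F (p + t *\<^sub>R w)) {t. p + t *\<^sub>R w \<in> V}"
  using assms(2)
proof (induction k arbitrary: F)
  case 0
  then show ?case
    by (auto intro!: continuous_on_compose2[of V F] continuous_intros)
next
  case (Suc k)
  let ?I = "{t::real. p + t *\<^sub>R w \<in> V}"
  have "open ?I"
    using open_vimage[OF assms(1), of "\<lambda>t. p + t *\<^sub>R w"]
    by (simp add: vimage_def continuous_on_add continuous_on_scaleR)
  have der: "((\<lambda>t. F (p + t *\<^sub>R w)) has_derivative
      (\<lambda>h. frechet_derivative F (at (p + t *\<^sub>R w)) (h *\<^sub>R w))) (at t)" if "t \<in> ?I" for t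
  proof -
    have "(F has_derivative frechet_derivative F (at (p + t *\<^sub>R w))) (at (p + t *\<^sub>R w))"
      using Suc.prems that by (simp add: frechet_derivative_works)
    moreover have "((\<lambda>t. p + t *\<^sub>R w) has_derivative (\<lambda>h. h *\<^sub>R w)) (at t)"
      by (auto intro!: derivative_eq_intros)
    ultimately show ?thesis
      using diff_chain_at by (fastforce simp: o_def)
  qed
  have "cont_diff k (\<lambda>t. frechet_derivative (\<lambda>t. F (p + t *\<^sub>R w)) (at t) h) ?I" for h
  proof -
    have "cont_diff k (\<lambda>t. frechet_derivative F (at (p + t *\<^sub>R w)) (h *\<^sub>R w)) ?I"
      using Suc.IH[of "\<lambda>z. frechet_derivative F (at z) (h *\<^sub>R w)"] Suc.prems by simp
    moreover have "frechet_derivative (\<lambda>t. F (p + t *\<^sub>R w)) (at t) h =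
        frechet_derivative F (at (p + t *\<^sub>R w)) (h *\<^sub>R w)" if "t \<in> ?I" for t
      by (simp add: frechet_derivative_at[OF der[OF that], symmetric])
    ultimately show ?thesis
      by (subst cont_diff_cong[OF \<open>open ?I\<close>])
  qed
  then show ?case
    using der by (auto simp: differentiable_def)
qed

lemma cont_diff_subset:
  assumes "cont_diff k F V" "U \<subseteq> V"
  shows "cont_diff k F U"
  using assms(1)
  by (induction k arbitrary: F) (use assms(2) in \<open>auto intro: continuous_on_subset\<close>)

lemma Ck_on_differentiable:
  assumes "Ck_on n F U" "1 \<le> n" "x \<in> U"
  shows "(F has_derivative frechet_derivative F (at x)) (at x)"
proof -
  have "cont_diff (Suc 0) F U"
    using assms(1,2) by (auto simp: Ck_on_def one_enat_def)
  then show ?thesis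
    using assms(3) by (simp add: frechet_derivative_works)
qed

section \<open>Tangent spaces and gradients\<close>

text \<open>Continuity at 0 comes from the derivative there. The filter \<open>nhds 0\<close>
  includes 0 itself, as is needed to replace a map by another one on an open neighbourhood when
  differentiating.\<close>

lemma smooth_curve_continuous:
  assumes "smooth_curve_through M x c" "(c has_vector_derivative v) (at 0)" "open U" "x \<in> U"
  shows "\<forall>\<^sub>F t in nhds 0. c t \<in> M \<inter> U"
proof -
  obtain e where e: "e > 0" "c ` {-e<..<e} \<subseteq> M" "c 0 = x"
    using assms(1) by (auto simp: smooth_curve_through_def)
  have "isCont c 0"
    using assms(2) has_vector_derivative_continuous by blast
  then have "\<forall>\<^sub>F t in nhds 0. c t \<in> U"
    using assms(3,4) e(3) by (simp add: continuous_within tendsto_def isCont_def eventually_at_filter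
        eventually_nhds) (metis)
  moreover have "\<forall>\<^sub>F t in nhds 0. c t \<in> M"
    using e by (intro eventually_nhds_in_open[of "{-e<..<e}" 0, THEN eventually_mono]) auto
  ultimately show ?thesis
    by eventually_elim auto
qed

lemma has_vector_derivative_eventually_eq:
  assumes "(c has_vector_derivative v) (at t)" "(b has_vector_derivative w) (at t)"
    and "\<forall>\<^sub>F u in nhds t. c u = b u"
  shows "v = w"
proof -
  obtain U where "open U" "t \<in> U" "\<And>u. u \<in> U \<Longrightarrow> c u = b u"
    using assms(3) by (auto simp: eventually_nhds)
  then have "(b has_vector_derivative v) (at t)"
    using has_vector_derivative_transform_within_open[OF assms(1)] by blast
  then show ?thesis
    using assms(2) vector_derivative_unique_at by blast
qed

text \<open>If \<open>z\<close> is the component of \<open>v\<close> orthogonal to \<open>S\<close>,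
  then \<open>z \<bullet> c u\<close> vanishes near \<open>t\<close>; hence so does its derivative
  \<open>z \<bullet> v\<close>, which equals \<open>z \<bullet> z\<close>.\<close>

lemma has_vector_derivative_subspace:
  fixes c :: "real \<Rightarrow> 'a::euclidean_space"
  assumes "subspace S" "(c has_vector_derivative v) (at t)" "\<forall>\<^sub>F u in nhds t. c u \<in> S"
  shows "v \<in> S"
proof -
  obtain y z where yz: "y \<in> S" "\<And>w. w \<in> S \<Longrightarrow> z \<bullet> w = 0" "v = y + z"
    using orthogonal_subspace_decomp_exists[of S v] assms(1)
    by (metis orthogonal_def span_eq_iff)
  have "((\<lambda>u. z \<bullet> c u) has_vector_derivative z \<bullet> v) (at t)"
    using bounded_linear.has_vector_derivative[OF bounded_linear_inner_right assms(2)] .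
  moreover have "((\<lambda>u. 0::real) has_vector_derivative 0) (at t)"
    by simp
  moreover have "\<forall>\<^sub>F u in nhds t. z \<bullet> c u = 0"
    using assms(3) by eventually_elim (simp add: yz)
  ultimately have "z \<bullet> v = 0"
    by (rule has_vector_derivative_eventually_eq)
  then have "z = 0"
    using yz by (simp add: inner_add_right)
  then show ?thesis
    using yz by simp
qed

lemma has_vector_derivative_chain:
  assumes "(c has_vector_derivative v) (at t)" "(F has_derivative D) (at (c t))"
  shows "((\<lambda>u. F (c u)) has_vector_derivative D v) (at t)"
proof -
  have "((\<lambda>u. F (c u)) has_derivative (\<lambda>h. D (h *\<^sub>R v))) (at t)"
    using diff_chain_at[OF assms(1)[unfolded has_vector_derivative_def] assms(2)]
    by (simp add: o_def)
  then show ?thesis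
    using linear_scale[OF has_derivative_linear[OF assms(2)]]
    by (simp add: has_vector_derivative_def)
qed

text \<open>In a slice chart the tangent space is the image of the model subspace \<open>S\<close>
  under the linear map \<open>D\<psi>(\<phi> x)\<close>.\<close>

lemma subspace_tangent_space:
  fixes M :: "'a::euclidean_space set"
  assumes "embedded_submanifold M" "x \<in> M"
  shows "subspace (tangent_space M x)"
proof -
  obtain U V \<phi> \<psi> S where ch: "x \<in> U" "Ck_on \<infinity> \<phi> U" "Ck_on \<infinity> \<psi> (V :: 'a set)"
      "homeomorphism U V \<phi> \<psi>" "subspace S" "\<phi> ` (M \<inter> U) = S \<inter> V"
    using assms unfolding embedded_submanifold_def by blast
  let ?A = "frechet_derivative \<phi> (at x)" and ?B = "frechet_derivative \<psi> (at (\<phi> x))"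
  have opn: "open U" "open V"
    using ch by (auto simp: Ck_on_def)
  have px: "\<phi> x \<in> S" "\<phi> x \<in> V"
    using ch(1,6) assms(2) by blast+
  have inv: "\<psi> (\<phi> y) = y" if "y \<in> U" for y
    using ch(4) that by (simp add: homeomorphism_def)
  have A: "(\<phi> has_derivative ?A) (at x)"
    using Ck_on_differentiable[OF ch(2)] ch(1) by simp
  have B: "(\<psi> has_derivative ?B) (at (\<phi> x))"
    using Ck_on_differentiable[OF ch(3)] px(2) by simp
  have "v \<in> ?B ` S" if v: "v \<in> tangent_space M x" for v
  proof -
    obtain c where c: "smooth_curve_through M x c" "(c has_vector_derivative v) (at 0)"
      using v by (auto simp: tangent_space_def)
    have c0: "c 0 = x"
      using c(1) by (simp add: smooth_curve_through_def)
    have ev: "\<forall>\<^sub>F t in nhds 0. c t \<in> M \<inter> U"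
      using smooth_curve_continuous[OF c opn(1) ch(1)] .
    have pc: "((\<lambda>t. \<phi> (c t)) has_vector_derivative ?A v) (at 0)"
      using has_vector_derivative_chain[OF c(2)] A c0 by simp
    have "\<forall>\<^sub>F t in nhds 0. \<phi> (c t) \<in> S"
      using ev by eventually_elim (use ch(6) in blast)
    then have "?A v \<in> S"
      using has_vector_derivative_subspace[OF ch(5) pc] by blast
    \<comment> \<open>Near 0 the curve coincides with its round trip through the chart, so the two
      velocities agree.\<close>
    moreover have "v = ?B (?A v)"
    proof (rule has_vector_derivative_eventually_eq[OF c(2)])
      show "((\<lambda>t. \<psi> (\<phi> (c t))) has_vector_derivative ?B (?A v)) (at 0)"
        using has_vector_derivative_chain[OF pc] B c0 by simp
      show "\<forall>\<^sub>F t in nhds 0. c t = \<psi> (\<phi> (c t))"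
        using ev by eventually_elim (simp add: inv)
    qed
    ultimately show ?thesis by blast
  qed
  moreover have "?B w \<in> tangent_space M x" if w: "w \<in> S" for w
  proof -
    \<comment> \<open>The witness for \<open>?B w\<close> is the straight line through
      \<open>\<phi> x\<close> with velocity \<open>w\<close>, pulled back by the chart. The line
      stays in \<open>S\<close>, and in \<open>V\<close> for small \<open>t\<close>, so the curve
      stays in \<open>M\<close>.\<close>
    let ?c = "\<lambda>t. \<psi> (\<phi> x + t *\<^sub>R w)" and ?I = "{t::real. \<phi> x + t *\<^sub>R w \<in> V}"
    have "open ?I"
      using open_vimage[OF opn(2), of "\<lambda>t. \<phi> x + t *\<^sub>R w"]
      by (simp add: vimage_def continuous_on_add continuous_on_scaleR)
    then obtain e where e: "e > 0" "ball 0 e \<subseteq> ?I"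
      using px(2) openE[of ?I 0] by auto
    have int: "{-e<..<e} = ball 0 e"
      by (simp add: ball_eq_greaterThanLessThan)
    have "Ck_on \<infinity> ?c {-e<..<e}"
      unfolding Ck_on_def int
      using cont_diff_subset[OF cont_diff_along_line[OF opn(2)] e(2)] ch(3)
      by (auto simp: Ck_on_def)
    moreover have "?c t \<in> M" if "t \<in> {-e<..<e}" for t
    proof -
      have "\<phi> x + t *\<^sub>R w \<in> V"
        using e(2) that int by blast
      moreover have "\<phi> x + t *\<^sub>R w \<in> S"
        using px(1) w ch(5) by (simp add: subspace_add subspace_mul)
      ultimately obtain y where "y \<in> M \<inter> U" "\<phi> x + t *\<^sub>R w = \<phi> y"
        using ch(6) by blast
      then show ?thesis
        by (simp add: inv)
    qed
    ultimately have "smooth_curve_through M x ?c"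
      using e(1) inv[OF ch(1)] unfolding smooth_curve_through_def
      by (intro conjI exI[of _ e] image_subsetI) auto
    moreover have "(?c has_vector_derivative ?B w) (at 0)"
      by (rule has_vector_derivative_chain)
        (use B in \<open>auto intro!: derivative_eq_intros\<close>)
    ultimately show ?thesis
      by (auto simp: tangent_space_def)
  qed
  ultimately have "tangent_space M x = ?B ` S"
    by blast
  then show ?thesis
    using linear_subspace_image[OF has_derivative_linear[OF B] ch(5)] by simp
qed

text \<open>Both \<open>differential\<close> and \<open>rgrad\<close> are definite descriptions, so
  existence and uniqueness have to be established for each. The gradient is found as the tangential
  part of the Euclidean gradient of a local extension of \<open>f\<close>.\<close>

lemma rgrad_in_tangent_space:
  fixes M :: "'a::euclidean_space set"
  assumes "embedded_submanifold M" "x \<in> M" "Ck_map 1 f M"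
  shows "rgrad M f x \<in> tangent_space M x"
proof -
  let ?T = "tangent_space M x"
  have sub: "subspace ?T"
    using subspace_tangent_space assms by blast
  obtain U F where F: "x \<in> U" "Ck_on 1 F U" "\<forall>y\<in>U \<inter> M. F y = f y"
    using assms unfolding Ck_map_def by blast
  let ?D = "frechet_derivative F (at x)"
  have D: "(F has_derivative ?D) (at x)"
    using Ck_on_differentiable[OF F(2) _ F(1)] by simp
  have der: "((\<lambda>t. f (c t)) has_real_derivative ?D v) (at 0)"
    if c: "smooth_curve_through M x c" "(c has_vector_derivative v) (at 0)" for c v
  proof -
    have "open U"
      using F(2) by (simp add: Ck_on_def)
    then have "\<forall>\<^sub>F t in nhds 0. c t \<in> M \<inter> U"
      using smooth_curve_continuous[OF c] F(1) by blast
    then obtain W where W: "open W" "0 \<in> W" "\<And>t. t \<in> W \<Longrightarrow> c t \<in> M \<inter> U"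
      by (auto simp: eventually_nhds)
    have "((\<lambda>t. F (c t)) has_vector_derivative ?D v) (at 0)"
      using has_vector_derivative_chain[OF c(2)] D c(1) by (simp add: smooth_curve_through_def)
    then have "((\<lambda>t. f (c t)) has_vector_derivative ?D v) (at 0)"
      by (rule has_vector_derivative_transform_within_open[OF _ W(1,2)]) (use F(3) W(3) in auto)
    then show ?thesis
      by (simp add: has_real_derivative_iff_has_vector_derivative)
  qed
  \<comment> \<open>All curves with velocity \<open>v\<close> give the value \<open>?D v\<close>;
    the existence of one such curve makes the value unique.\<close>
  have diff: "differential M f x v = ?D v" if v: "v \<in> ?T" for v
  proof -
    obtain c where c: "smooth_curve_through M x c" "(c has_vector_derivative v) (at 0)"
      using v by (auto simp: tangent_space_def)
    show ?thesis
      unfolding differential_def using der c DERIV_unique by (intro the_equality) blast+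
  qed
  \<comment> \<open>The Riesz representative of \<open>?D\<close>, i.e. the Euclidean gradient of
    the extension \<open>F\<close> at \<open>x\<close>.\<close>
  define w where "w = (\<Sum>b\<in>Basis. ?D b *\<^sub>R b)"
  have w: "w \<bullet> v = ?D v" for v
  proof -
    have "?D v = ?D (\<Sum>b\<in>Basis. (v \<bullet> b) *\<^sub>R b)"
      by (simp add: euclidean_representation)
    also have "\<dots> = (\<Sum>b\<in>Basis. (v \<bullet> b) * ?D b)"
      using has_derivative_linear[OF D] by (simp add: linear_sum linear_scale)
    finally show ?thesis
      by (simp add: w_def inner_sum_left inner_commute[of v] mult.commute)
  qed
  \<comment> \<open>The candidate \<open>g\<close> is the orthogonal projection of \<open>w\<close>
    onto the tangent space; the normal part \<open>z\<close> is invisible to tangent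
    vectors.\<close>
  obtain g z where gz: "g \<in> ?T" "\<And>v. v \<in> ?T \<Longrightarrow> z \<bullet> v = 0" "w = g + z"
    using orthogonal_subspace_decomp_exists[of ?T w] sub by (metis orthogonal_def span_eq_iff)
  have g: "g \<bullet> v = differential M f x v" if "v \<in> ?T" for v
    using gz(2,3) w[of v] diff that by (simp add: inner_add_left)
  \<comment> \<open>The difference of two candidates is itself tangent, hence orthogonal to
    itself.\<close>
  have "h = g" if "h \<in> ?T" "\<forall>v\<in>?T. h \<bullet> v = differential M f x v" for h
  proof -
    have "h - g \<in> ?T"
      using that(1) gz(1) sub by (simp add: subspace_diff)
    then have "(h - g) \<bullet> (h - g) = 0"
      using that(2) g by (simp add: inner_diff_left)
    then show ?thesis by simp
  qed
  then have "rgrad M f x = g"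
    unfolding rgrad_def using gz(1) g by (intro the_equality) blast+
  then show ?thesis
    using gz(1) by simp
qed

section \<open>Directions and line search\<close>

text \<open>Every branch yields a linear combination of the gradient and the transported step
  \<open>s\<close>. The condition on \<open>prev\<close> ensures that the transport is applied to a
  tangent vector.\<close>

lemma direction_in_tangent_space:
  fixes M :: "'a::euclidean_space set"
  assumes M: "embedded_submanifold M" and f: "Ck_map 1 f M" and T: "vector_transport M T"
    and x: "pt \<sigma> \<in> M"
    and prev: "\<And>x' d' \<eta>'. prev \<sigma> = Some (x', d', \<eta>') \<Longrightarrow> x' \<in> M \<and> d' \<in> tangent_space M x'"
  shows "direction P M T f \<sigma> \<in> tangent_space M (pt \<sigma>)"
proof -
  have sub: "subspace (tangent_space M (pt \<sigma>))" and g: "rgrad M f (pt \<sigma>) \<in> tangent_space M (pt \<sigma>)"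
    using subspace_tangent_space rgrad_in_tangent_space M f x by auto
  show ?thesis
  proof (cases "prev \<sigma>")
    case None
    then show ?thesis
      using sub g by (simp add: direction_def subspace_neg subspace_mul)
  next
    case (Some p)
    obtain x' d' \<eta>' where p: "p = (x', d', \<eta>')" by (cases p)
    then have "x' \<in> M" "d' \<in> tangent_space M x'"
      using prev Some by auto
    then have "T (pt \<sigma>) x' (\<eta>' *\<^sub>R d') \<in> tangent_space M (pt \<sigma>)"
      using T x subspace_mul[OF subspace_tangent_space[OF M]] unfolding vector_transport_def by blast
    then show ?thesis
      using Some p sub g
      by (auto simp: direction_def Let_def intro!: subspace_neg subspace_mul subspace_diff subspace_add)
  qed
qed

lemma steepest_descent_bounds:
  fixes g :: "'a::real_inner"
  assumes "0 < c" "c \<le> l" "l \<le> C"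
  shows "g \<bullet> (- l *\<^sub>R g) \<le> - c * (norm g)\<^sup>2 \<and> norm (- l *\<^sub>R g) \<le> C * norm g"
  using assms by (auto simp: dot_square_norm intro!: mult_right_mono)

text \<open>A momentum direction is kept only if it passes the test, whose negation is exactly these
  two bounds. All other branches are \<open>- l *\<^sub>R g\<close> with \<open>l\<close> between
  \<open>c1 P\<close> and \<open>c2 P\<close>.\<close>

lemma direction_bounds:
  assumes "valid_params P"
  shows "rgrad M f (pt \<sigma>) \<bullet> direction P M T f \<sigma> \<le> - c1 P * (norm (rgrad M f (pt \<sigma>)))\<^sup>2 \<and>
         norm (direction P M T f \<sigma>) \<le> c2 P * norm (rgrad M f (pt \<sigma>))"
proof -
  have P: "0 < c1 P" "c1 P \<le> lam_min P" "lam_min P \<le> lam_0 P" "lam_0 P \<le> lam_max P" "lam_max P \<le> c2 P"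
    using assms by (auto simp: valid_params_def)
  note * = steepest_descent_bounds[OF P(1), where C = "c2 P" and g = "rgrad M f (pt \<sigma>)"]
  have l0: "c1 P \<le> lam_0 P" "lam_0 P \<le> c2 P" and lm: "c1 P \<le> lam_max P" "lam_max P \<le> c2 P"
    using P by linarith+
  have l: "c1 P \<le> min (lam_max P) (max (lam_min P) q)" "min (lam_max P) (max (lam_min P) q) \<le> c2 P" for q
    using P by (simp_all add: min_def max_def)
  show ?thesis
    using *[OF l0] *[OF lm] *[OF l]
    unfolding direction_def Let_def
    by (cases "prev \<sigma>") (simp_all only: option.case prod.case split: prod.split if_split, auto simp: not_less)
qed

text \<open>Here \<open>p\<close> and \<open>q\<close> stand for the current and the trial value of
  \<open>f\<close>, \<open>a\<close> for \<open>- (g \<bullet> d)\<close>, \<open>D\<close> for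
  \<open>norm d\<close> and \<open>G\<close> for \<open>norm g\<close>. The bound on \<eta> makes
  the quadratic error at most the share \<open>(1 - \<gamma>) * \<eta> * a\<close> of the linear
  decrease.\<close>

lemma armijo_condition:
  fixes L \<gamma> \<eta> a D G p q c C :: real
  assumes "q \<le> p - \<eta> * a + L / 2 * (\<eta> * D)\<^sup>2" "c * G\<^sup>2 \<le> a" "0 \<le> D" "D \<le> C * G"
    and "0 < L" "0 < C" "\<gamma> < 1" "0 < \<eta>" "\<eta> \<le> 2 * (1 - \<gamma>) * c / (L * C\<^sup>2)"
  shows "q \<le> p - \<gamma> * \<eta> * a"
proof -
  have "D\<^sup>2 \<le> C\<^sup>2 * G\<^sup>2"
    using assms(3,4) by (metis power_mono power_mult_distrib)
  then have "L / 2 * \<eta> * D\<^sup>2 \<le> L / 2 * \<eta> * (C\<^sup>2 * G\<^sup>2)"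
    using assms by (intro mult_left_mono) auto
  also have "\<dots> = (\<eta> * (L * C\<^sup>2)) / 2 * G\<^sup>2"
    by simp
  also have "\<dots> \<le> (2 * (1 - \<gamma>) * c) / 2 * G\<^sup>2"
    using assms by (intro mult_right_mono divide_right_mono) (auto simp: pos_le_divide_eq)
  also have "\<dots> = (1 - \<gamma>) * (c * G\<^sup>2)"
    by simp
  also have "\<dots> \<le> (1 - \<gamma>) * a"
    using assms(2,7) by (intro mult_left_mono) auto
  finally have "\<eta> * (L / 2 * \<eta> * D\<^sup>2) \<le> \<eta> * ((1 - \<gamma>) * a)"
    using assms by (intro mult_left_mono) auto
  then show ?thesis
    using assms(1) by (simp add: algebra_simps power2_eq_square)
qed

text \<open>Backtracking stops at the first acceptable exponent, which is at most any known
  acceptable \<open>N\<close>. The counter starts at 1, so exponent \<open>j\<close> corresponds to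
  \<open>Suc j\<close> trials.\<close>

lemma line_search_terminates:
  assumes "f (R x (delta P ^ N *\<^sub>R d)) \<le> f x + gamma P * delta P ^ N * (g \<bullet> d)"
  obtains j where "j \<le> N" "line_search P R f x g d = Some (delta P ^ j, Suc j)"
    "f (R x (delta P ^ j *\<^sub>R d)) \<le> f x + gamma P * delta P ^ j * (g \<bullet> d)"
proof -
  let ?b = "\<lambda>(\<eta>, m::nat). f (R x (\<eta> *\<^sub>R d)) > f x + gamma P * \<eta> * (g \<bullet> d)"
  let ?c = "\<lambda>(\<eta>, m). (delta P * \<eta>, Suc m)"
  have it: "(?c ^^ j) (1, 1) = (delta P ^ j, Suc j)" for j
    by (induction j) auto
  let ?j = "LEAST j. \<not> ?b ((?c ^^ j) (1, 1))"
  have N: "\<not> ?b ((?c ^^ N) (1, 1))"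
    unfolding it using assms by simp
  have "\<not> ?b ((?c ^^ ?j) (1, 1))"
    using LeastI[of "\<lambda>j. \<not> ?b ((?c ^^ j) (1, 1))", OF N] .
  then have "f (R x (delta P ^ ?j *\<^sub>R d)) \<le> f x + gamma P * delta P ^ ?j * (g \<bullet> d)"
    unfolding it[of ?j] by simp
  moreover have "?j \<le> N"
    using N by (rule Least_le)
  \<comment> \<open>By definition, \<open>while_option\<close> returns the state at the least
    exponent violating the loop condition, provided one exists; \<open>N\<close> is the
    witness.\<close>
  moreover have "line_search P R f x g d = Some ((?c ^^ ?j) (1, 1))"
    unfolding line_search_def while_option_def by (rule if_P) (rule exI, rule N)
  ultimately show ?thesis
    using that unfolding it[of ?j] by blast
qed


section \<open>Complexity\<close>

text \<open>The loop invariant: the stored previous point and direction are included because the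
  next direction transports them.\<close>

definition tangent_state :: "'a::euclidean_space set \<Rightarrow> 'a rgmm_state \<Rightarrow> bool" where
  "tangent_state M \<sigma> \<longleftrightarrow> pt \<sigma> \<in> M \<and>
     (\<forall>x' d' \<eta>'. prev \<sigma> = Some (x', d', \<eta>') \<longrightarrow> x' \<in> M \<and> d' \<in> tangent_space M x')"

text \<open>Exponent \<open>N\<close> is acceptable by the Armijo estimate, so at most
  \<open>N + 1\<close> steps are tried; the update repeats one retraction and one evaluation, whence
  \<open>N + 2\<close>.\<close>

lemma rgmm_step_decrease:
  fixes M :: "'a::euclidean_space set"
  assumes P: "valid_params P" and L: "L > 0"
    and N: "delta P ^ N \<le> 2 * (1 - gamma P) * c1 P / (L * (c2 P)\<^sup>2)"
    and M: "embedded_submanifold M" and R: "retractions_on M r R" and T: "vector_transport M T"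
    and f: "Ck_map 1 f M" and \<sigma>: "tangent_state M \<sigma>"
    and \<epsilon>: "\<epsilon> > 0" "norm (rgrad M f (pt \<sigma>)) > \<epsilon>"
    and \<rho>: "\<rho> > ereal (norm (direction P M T f \<sigma>))"
    and reg: "\<And>d. \<lbrakk>d \<in> tangent_space M (pt \<sigma>); ereal (norm d) < \<rho>\<rbrakk> \<Longrightarrow>
       d \<in> retr_dom M r (pt \<sigma>) \<and>
       \<bar>f (R (pt \<sigma>) d) - f (pt \<sigma>) - rgrad M f (pt \<sigma>) \<bullet> d\<bar> \<le> L / 2 * (norm d)\<^sup>2"
  obtains \<sigma>' where "rgmm_step P M R T f \<epsilon> \<sigma> = Some \<sigma>'" "tangent_state M \<sigma>'"
    "f (pt \<sigma>') \<le> f (pt \<sigma>) - gamma P * delta P ^ N * c1 P * \<epsilon>\<^sup>2"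
    "n_retr \<sigma>' \<le> n_retr \<sigma> + (N + 2)" "n_feval \<sigma>' \<le> n_feval \<sigma> + (N + 2)"
    "n_geval \<sigma>' = n_geval \<sigma> + 1"
proof -
  define x where "x = pt \<sigma>"
  define g where "g = rgrad M f x"
  define d where "d = direction P M T f \<sigma>"
  have P': "0 < gamma P" "gamma P < 1" "0 < delta P" "delta P < 1" "0 < c1 P" "0 < c2 P"
    using P by (auto simp: valid_params_def)
  have x: "x \<in> M"
    using \<sigma> by (simp add: tangent_state_def x_def)
  have d: "d \<in> tangent_space M x"
    unfolding d_def x_def by (rule direction_in_tangent_space[OF M f T]) (use \<sigma> in \<open>auto simp: tangent_state_def\<close>)
  have gd: "g \<bullet> d \<le> - c1 P * (norm g)\<^sup>2" "norm d \<le> c2 P * norm g"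
    using direction_bounds[OF P] unfolding g_def d_def x_def by blast+
  \<comment> \<open>Step sizes never exceed 1, so every trial vector has norm at most
    \<open>norm d\<close>, which is below \<rho>: the retraction is defined there and the quadratic
    bound holds.\<close>
  have trial: "\<eta> *\<^sub>R d \<in> retr_dom M r x \<and>
      \<bar>f (R x (\<eta> *\<^sub>R d)) - f x - g \<bullet> (\<eta> *\<^sub>R d)\<bar> \<le> L / 2 * (norm (\<eta> *\<^sub>R d))\<^sup>2"
    if "0 \<le> \<eta>" "\<eta> \<le> 1" for \<eta>
  proof -
    have "norm (\<eta> *\<^sub>R d) \<le> norm d"
      using that by (simp add: mult_left_le_one_le)
    then have "ereal (norm (\<eta> *\<^sub>R d)) < \<rho>"
      using \<rho> unfolding d_def by (meson ereal_less_eq(3) order_le_less_trans)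
    moreover have "\<eta> *\<^sub>R d \<in> tangent_space M x"
      using d by (rule subspace_mul[OF subspace_tangent_space[OF M x]])
    ultimately show ?thesis
      using reg unfolding x_def g_def by blast
  qed
  have "f (R x (delta P ^ N *\<^sub>R d)) \<le> f x - gamma P * delta P ^ N * (- (g \<bullet> d))"
  proof (rule armijo_condition[where L = L and D = "norm d" and G = "norm g" and c = "c1 P" and C = "c2 P"])
    show "f (R x (delta P ^ N *\<^sub>R d)) \<le> f x - delta P ^ N * - (g \<bullet> d) + L / 2 * (delta P ^ N * norm d)\<^sup>2"
      using trial[of "delta P ^ N"] P' unfolding abs_le_iff by (simp add: power_le_one)
  qed (use gd P' L N in auto)
  then obtain j where j: "j \<le> N" "line_search P R f x g d = Some (delta P ^ j, Suc j)"
      "f (R x (delta P ^ j *\<^sub>R d)) \<le> f x + gamma P * delta P ^ j * (g \<bullet> d)"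
    using line_search_terminates[of f R x P N d g] by auto
  let ?\<sigma>' = "\<lparr> pt = R x (delta P ^ j *\<^sub>R d), prev = Some (x, d, delta P ^ j),
      n_retr = n_retr \<sigma> + Suc j + 1, n_feval = n_feval \<sigma> + Suc j + 1, n_geval = n_geval \<sigma> + 1 \<rparr>"
  have step: "rgmm_step P M R T f \<epsilon> \<sigma> = Some ?\<sigma>'"
    using \<epsilon>(2) j(2) by (simp add: rgmm_step_def Let_def x_def g_def d_def)
  have "R x (delta P ^ j *\<^sub>R d) \<in> M"
    using R x trial[of "delta P ^ j"] P' unfolding retractions_on_def by (auto simp: power_le_one)
  then have tan: "tangent_state M ?\<sigma>'"
    using x d by (simp add: tangent_state_def)
  \<comment> \<open>The accepted step is at least \<open>delta P ^ N\<close> because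
    \<open>j \<le> N\<close>, and the slope satisfies
    \<open>- (g \<bullet> d) \<ge> c1 P * \<epsilon>\<^sup>2\<close> because the stopping test
    failed.\<close>
  have "delta P ^ N * (c1 P * \<epsilon>\<^sup>2) \<le> delta P ^ j * (- (g \<bullet> d))"
  proof (rule mult_mono)
    have "c1 P * \<epsilon>\<^sup>2 \<le> c1 P * (norm g)\<^sup>2"
      using \<epsilon> P' by (intro mult_left_mono power_mono) (auto simp: g_def x_def)
    then show "c1 P * \<epsilon>\<^sup>2 \<le> - (g \<bullet> d)"
      using gd(1) by simp
  qed (use P' j(1) in \<open>auto intro: power_decreasing\<close>)
  then have "gamma P * (delta P ^ N * (c1 P * \<epsilon>\<^sup>2)) \<le> gamma P * (delta P ^ j * (- (g \<bullet> d)))"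
    using P'(1) by (intro mult_left_mono) auto
  then have "f (pt ?\<sigma>') \<le> f (pt \<sigma>) - gamma P * delta P ^ N * c1 P * \<epsilon>\<^sup>2"
    using j(3) by (simp add: x_def mult.assoc)
  then show ?thesis
    by (rule that[OF step tan]) (use j(1) in auto)
qed

text \<open>Sums the decrease and the costs over the first \<open>k\<close> iterations. The stopping
  test is assumed to fail only at indices below \<open>k\<close>, so the bounds also cover the first
  index at which it succeeds.\<close>

lemma rgmm_iter_decrease:
  fixes M :: "'a::euclidean_space set"
  assumes P: "valid_params P" and L: "L > 0"
    and N: "delta P ^ N \<le> 2 * (1 - gamma P) * c1 P / (L * (c2 P)\<^sup>2)"
    and M: "embedded_submanifold M" and R: "retractions_on M r R" and T: "vector_transport M T"
    and f: "Ck_map 1 f M" and x0: "x0 \<in> M" and \<epsilon>: "\<epsilon> > 0"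
    and reg: "pullbacks_regular P M r R T f \<epsilon> x0 L"
    and run: "\<And>k' \<sigma>'. \<lbrakk>k' < k; rgmm_iter P M R T f \<epsilon> x0 k' = Some \<sigma>'\<rbrakk> \<Longrightarrow> norm (rgrad M f (pt \<sigma>')) > \<epsilon>"
  shows "\<exists>\<sigma>. rgmm_iter P M R T f \<epsilon> x0 k = Some \<sigma> \<and> tangent_state M \<sigma> \<and>
    f (pt \<sigma>) \<le> f x0 - real k * (gamma P * delta P ^ N * c1 P * \<epsilon>\<^sup>2) \<and>
    n_retr \<sigma> \<le> k * (N + 2) \<and> n_feval \<sigma> \<le> 1 + k * (N + 2) \<and> n_geval \<sigma> = 1 + k"
  using run
proof (induction k)
  case 0
  then show ?case
    using x0 by (simp add: tangent_state_def)
next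
  case (Suc k)
  then obtain \<sigma> where \<sigma>: "rgmm_iter P M R T f \<epsilon> x0 k = Some \<sigma>" "tangent_state M \<sigma>"
    "f (pt \<sigma>) \<le> f x0 - real k * (gamma P * delta P ^ N * c1 P * \<epsilon>\<^sup>2)"
    "n_retr \<sigma> \<le> k * (N + 2)" "n_feval \<sigma> \<le> 1 + k * (N + 2)" "n_geval \<sigma> = 1 + k"
    by (metis less_Suc_eq)
  have big: "norm (rgrad M f (pt \<sigma>)) > \<epsilon>"
    using Suc.prems \<sigma>(1) by blast
  obtain \<rho> :: ereal where \<rho>: "\<rho> > ereal (norm (direction P M T f \<sigma>))"
    "\<And>d. \<lbrakk>d \<in> tangent_space M (pt \<sigma>); ereal (norm d) < \<rho>\<rbrakk> \<Longrightarrow>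
       d \<in> retr_dom M r (pt \<sigma>) \<and>
       \<bar>f (R (pt \<sigma>) d) - f (pt \<sigma>) - rgrad M f (pt \<sigma>) \<bullet> d\<bar> \<le> L / 2 * (norm d)\<^sup>2"
    using reg \<sigma>(1) big unfolding pullbacks_regular_def by blast
  obtain \<sigma>' where \<sigma>': "rgmm_step P M R T f \<epsilon> \<sigma> = Some \<sigma>'" "tangent_state M \<sigma>'"
    "f (pt \<sigma>') \<le> f (pt \<sigma>) - gamma P * delta P ^ N * c1 P * \<epsilon>\<^sup>2"
    "n_retr \<sigma>' \<le> n_retr \<sigma> + (N + 2)" "n_feval \<sigma>' \<le> n_feval \<sigma> + (N + 2)"
    "n_geval \<sigma>' = n_geval \<sigma> + 1"
    by (rule rgmm_step_decrease[OF P L N M R T f \<sigma>(2) \<epsilon> big \<rho>])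
  have "f (pt \<sigma>') \<le> f x0 - real (Suc k) * (gamma P * delta P ^ N * c1 P * \<epsilon>\<^sup>2)"
    using \<sigma>'(3) \<sigma>(3) by (simp add: algebra_simps)
  then show ?case
    using \<sigma> \<sigma>' by simp
qed

text \<open>The order is made uniform: \<open>C\<close> is chosen before the manifold, the function,
  the starting point and \<epsilon>, and depends only on \<open>P\<close>, \<open>L\<close> and the
  bound \<Delta> on the initial gap. The additional 1 counts the evaluations at
  \<open>x0\<close>.\<close>

theorem proposition6p1:
  fixes P :: rgmm_params and L \<Delta> :: real
  assumes "valid_params P" and "L > 0"
  shows "\<exists>C::real. \<forall>(M :: 'a::euclidean_space set) r R T f f_low x0 \<epsilon>.
    embedded_submanifold M \<and> retractions_on M r R \<and> vector_transport M T \<and>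
    Ck_map 1 f M \<and> x0 \<in> M \<and> \<epsilon> > 0 \<and>
    (\<forall>x\<in>M. f x \<ge> f_low) \<and> f x0 - f_low \<le> \<Delta> \<and>
    pullbacks_regular P M r R T f \<epsilon> x0 L \<longrightarrow>
    (\<exists>K \<sigma>. rgmm_iter P M R T f \<epsilon> x0 K = Some \<sigma> \<and>
       norm (rgrad M f (pt \<sigma>)) \<le> \<epsilon> \<and>
       real K \<le> C / \<epsilon>\<^sup>2 \<and>
       real (n_retr \<sigma>) \<le> C / \<epsilon>\<^sup>2 \<and>
       real (n_feval \<sigma>) \<le> 1 + C / \<epsilon>\<^sup>2 \<and>
       real (n_geval \<sigma>) \<le> 1 + C / \<epsilon>\<^sup>2)"
proof -
  have P: "0 < gamma P" "gamma P < 1" "0 < delta P" "delta P < 1" "0 < c1 P" "0 < c2 P"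
    using assms(1) by (auto simp: valid_params_def)
  have "0 < 2 * (1 - gamma P) * c1 P / (L * (c2 P)\<^sup>2)"
    using P assms(2) by simp
  \<comment> \<open>\<open>N\<close> depends only on \<open>P\<close> and \<open>L\<close>, and
    hence so does the decrease factor \<open>q\<close> below.\<close>
  then obtain N where N: "delta P ^ N \<le> 2 * (1 - gamma P) * c1 P / (L * (c2 P)\<^sup>2)"
    using real_arch_pow_inv[OF _ P(4)] less_imp_le by blast
  define q where "q = gamma P * delta P ^ N * c1 P"
  have q: "q > 0"
    using P by (simp add: q_def)
  \<comment> \<open>At most \<open>\<Delta> / (q * \<epsilon>\<^sup>2)\<close> iterations, each
    costing at most \<open>N + 2\<close> retractions and function evaluations.\<close>
  define C where "C = real (N + 2) * (\<Delta> / q)"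
  show ?thesis
  proof (intro exI[of _ C] allI impI, elim conjE)
    fix M :: "'a set" and r R T f f_low x0 and \<epsilon> :: real
    assume M: "embedded_submanifold M" and R: "retractions_on M r R" and T: "vector_transport M T"
      and f: "Ck_map 1 f M" and x0: "x0 \<in> M" and \<epsilon>: "\<epsilon> > 0"
      and low: "\<forall>x\<in>M. f x \<ge> f_low" and \<Delta>: "f x0 - f_low \<le> \<Delta>"
      and reg: "pullbacks_regular P M r R T f \<epsilon> x0 L"
    let ?iter = "rgmm_iter P M R T f \<epsilon> x0"
    let ?stop = "\<lambda>k. \<exists>\<sigma>. ?iter k = Some \<sigma> \<and> norm (rgrad M f (pt \<sigma>)) \<le> \<epsilon>"
    have state: "\<exists>\<sigma>. ?iter k = Some \<sigma> \<and> n_retr \<sigma> \<le> k * (N + 2) \<and> n_feval \<sigma> \<le> 1 + k * (N + 2) \<and>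
        n_geval \<sigma> = 1 + k \<and> real k \<le> \<Delta> / q / \<epsilon>\<^sup>2"
      if "\<And>k'. k' < k \<Longrightarrow> \<not> ?stop k'" for k
    proof -
      have "norm (rgrad M f (pt \<sigma>')) > \<epsilon>" if "k' < k" "?iter k' = Some \<sigma>'" for k' \<sigma>'
        using \<open>\<And>k'. k' < k \<Longrightarrow> \<not> ?stop k'\<close> that by force
      then obtain \<sigma> where \<sigma>: "?iter k = Some \<sigma>" "tangent_state M \<sigma>"
        "f (pt \<sigma>) \<le> f x0 - real k * (q * \<epsilon>\<^sup>2)"
        "n_retr \<sigma> \<le> k * (N + 2)" "n_feval \<sigma> \<le> 1 + k * (N + 2)" "n_geval \<sigma> = 1 + k"
        using rgmm_iter_decrease[OF assms N M R T f x0 \<epsilon> reg] unfolding q_def by blast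
      have "f_low \<le> f (pt \<sigma>)"
        using low \<sigma>(2) by (simp add: tangent_state_def)
      \<comment> \<open>The total decrease over \<open>k\<close> iterations cannot exceed the
        initial gap.\<close>
      then have "real k * (q * \<epsilon>\<^sup>2) \<le> \<Delta>"
        using \<sigma>(3) \<Delta> by linarith
      then have "real k \<le> \<Delta> / q / \<epsilon>\<^sup>2"
        using q \<epsilon> by (simp add: pos_le_divide_eq mult_ac)
      then show ?thesis
        using \<sigma> by blast
    qed
    have "\<exists>k. ?stop k"
    \<comment> \<open>Without a stop, the iteration bound would hold for every natural number
      \<open>k\<close>.\<close>
    proof (rule ccontr)
      assume "\<not> (\<exists>k. ?stop k)"
      then have "real k \<le> \<Delta> / q / \<epsilon>\<^sup>2" for k
        using state by blast
      then show False
        using reals_Archimedean2[of "\<Delta> / q / \<epsilon>\<^sup>2"] by (meson not_less)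
    qed
    \<comment> \<open>Taking the least stopping index lets \<open>state\<close> apply to
      \<open>K\<close> itself.\<close>
    then obtain K where K: "?stop K" "\<And>k. k < K \<Longrightarrow> \<not> ?stop k"
      using exists_least_iff[of ?stop] by blast
    then obtain \<sigma> where \<sigma>: "?iter K = Some \<sigma>" "n_retr \<sigma> \<le> K * (N + 2)" "n_feval \<sigma> \<le> 1 + K * (N + 2)"
        "n_geval \<sigma> = 1 + K" "real K \<le> \<Delta> / q / \<epsilon>\<^sup>2"
      using state by blast
    have "real (K * (N + 2)) = real (N + 2) * real K"
      by (simp add: algebra_simps)
    also have "\<dots> \<le> real (N + 2) * (\<Delta> / q / \<epsilon>\<^sup>2)"
      using \<sigma>(5) by (rule mult_left_mono) simp
    finally have KC: "real (K * (N + 2)) \<le> C / \<epsilon>\<^sup>2"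
      by (simp add: C_def)
    have "real K \<le> real (K * (N + 2))"
      by (subst of_nat_le_iff) simp
    then have "real K \<le> C / \<epsilon>\<^sup>2" "real (n_retr \<sigma>) \<le> C / \<epsilon>\<^sup>2" "real (n_feval \<sigma>) \<le> 1 + C / \<epsilon>\<^sup>2"
      "real (n_geval \<sigma>) \<le> 1 + C / \<epsilon>\<^sup>2"
      using KC \<sigma>(2-4) by linarith+
    then show "\<exists>K \<sigma>. ?iter K = Some \<sigma> \<and> norm (rgrad M f (pt \<sigma>)) \<le> \<epsilon> \<and> real K \<le> C / \<epsilon>\<^sup>2 \<and>
       real (n_retr \<sigma>) \<le> C / \<epsilon>\<^sup>2 \<and> real (n_feval \<sigma>) \<le> 1 + C / \<epsilon>\<^sup>2 \<and> real (n_geval \<sigma>) \<le> 1 + C / \<epsilon>\<^sup>2"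
      using K(1) \<sigma>(1) by (intro exI[of _ K] exI[of _ \<sigma>]) auto
  qed
qed

end
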